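(* Let $x\in\Sigma_q^n$ and $1\le t\le\min\{\ell-2,\frac{\ell}{2}\}$. Suppose that $\mathcal R'$ is obtained from $\mathcal R_\ell(\tilde x)$ by deleting $t$ arbitrary $\ell$-mers, and that $\mathcal R''$ is the consistent vector of $\ell$-mers obtained by inserting a minimum number $s$ of $\ell$-mers into $\mathcal R'$, where $0\le s<t$. Let $y=\mathcal R_\ell^{-1}(\mathcal R'')$. (i) The sequences $\tilde x$ and $y$ contain the same number of $(\ell,t,\le t-1)$-check patterns. (ii) Let $p'$ be the $i$-th $(\ell,t,\le t-1)$-check pattern in $y$, and let $p$ be the $i$-th $(\ell,t,\le t-1)$-check pattern in $\tilde x$. Then $p'$ and $p$ have the same minimum period. If $p$ is not an $(\ell,t,s)$-check pattern, then $p'=p$ (as sequences). If $p$ is an $(\ell,t,s)$-check pattern, then either $p'=p$, or $p'$ is obtained from $p$ by deleting some complete minimum periods.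
   Context: $q\ge2$, $\Sigma_q=\{0,1,\dots,q-1\}$; $z_{[a,b]}=z_az_{a+1}\cdots z_b$ denotes a substring (substrings are identified with their positions, and are ordered from left to right). An $\ell$-mer is an element of $\Sigma_q^\ell$. Channel: two known $\ell$-mers $u,v\in\Sigma_q^\ell$ are fixed, and $\tilde x=uxv$, with coordinates indexed by $-\ell+1,\dots,n+\ell$, so that $\tilde x_{[-\ell+1,0]}=u$, $\tilde x_{[1,n]}=x$, $\tilde x_{[n+1,n+\ell]}=v$. The read vector is $\mathcal R_\ell(\tilde x)=(s_0,s_1,\dots,s_{n+\ell})$ with $s_i=\tilde x_{[i-\ell+1,i]}$. Deleting $\ell$-mers means passing to a (not necessarily contiguous) subvector; throughout it is assumed that the first and last $\ell$-mers $s_0$ and $s_{n+\ell}$ are not deleted. Consistency: two $\ell$-mers $y_1\cdots y_\ell$ and $z_1\cdots z_\ell$ (in this order) are consistent if $y_2\cdots y_\ell=z_1\cdots z_{\ell-1}$. A vector of $\ell$-mers is consistent if every two adjacent entries are consistent. For a consistent vector $(r_1,\dots,r_m)$ with $r_i=r_{i,1}\cdots r_{i,\ell}$, $\mathcal R_\ell^{-1}(r_1,\dots,r_m)$ denotes the sequence $r_{1,1}\cdots r_{1,\ell}r_{2,\ell}\cdots r_{m,\ell}$. Periodicity: a sequence $z$ of length at least $T+1$ is $T$-periodic (has period $T$) if $z_i=z_{i+T}$ for all $1\le i\le |z|-T$; its minimum period is its smallest period. A maximal $T$-periodic substring of $z$ is a $T$-periodic substring not contained in a longer $T$-periodic substring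 of $z$. Deleting several complete minimum periods from a periodic sequence with minimum period $T$ means applying several bursts of deletions (deletions of substrings), each of length divisible by $T$. Check patterns: for $0\le s<\min\{\ell-1,t\}$, a periodic substring $p$ of $z$ with minimum period $T$ is an $(\ell,t,s)$-check pattern in $z$ if (i) $T\le t-s$; (ii) $p$ is a maximal periodic substring of $z$ with minimum period $T$; (iii) $|p|\ge \ell-1-s$. It is an $(\ell,t,\le t-1)$-check pattern if it is an $(\ell,t,s')$-check pattern for some $0\le s'\le t-1$. *)

theory Defs
  imports "HOL-Library.Sublist"
begin

text \<open>Sequences are 0-based lists. A substring is identified with its position, a pair
  \<open>(a, b)\<close> of its first index and the index just after its last one.\<close>

definition words :: "nat \<Rightarrow> nat \<Rightarrow> nat list set" where
  "words q m = {w. set w \<subseteq> {0..<q} \<and> length w = m}"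

definition substr :: "'a list \<Rightarrow> nat \<times> nat \<Rightarrow> 'a list" where
  "substr z = (\<lambda>(a, b). take (b - a) (drop a z))"

definition read_vector :: "nat \<Rightarrow> 'a list \<Rightarrow> 'a list list" where
  "read_vector l z = map (\<lambda>i. substr z (i, i + l)) [0..<Suc (length z) - l]"

definition consistent :: "'a list list \<Rightarrow> bool" where
  "consistent rs \<longleftrightarrow> successively (\<lambda>r r'. tl r = butlast r') rs"

definition inv_read :: "'a list list \<Rightarrow> 'a list" where
  "inv_read rs = hd rs @ map last (tl rs)"

definition consistent_insertion ::
    "nat \<Rightarrow> nat \<Rightarrow> nat list list \<Rightarrow> nat \<Rightarrow> nat list list \<Rightarrow> bool" where
  "consistent_insertion q l R s R2 \<longleftrightarrow>
     set R2 \<subseteq> words q l \<and> consistent R2 \<and> subseq R R2 \<and> length R2 = length R + s"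

definition min_consistent_insertion ::
    "nat \<Rightarrow> nat \<Rightarrow> nat list list \<Rightarrow> nat \<Rightarrow> nat list list \<Rightarrow> bool" where
  "min_consistent_insertion q l R s R2 \<longleftrightarrow>
     consistent_insertion q l R s R2 \<and>
     (\<forall>s' R3. consistent_insertion q l R s' R3 \<longrightarrow> s \<le> s')"

definition periodic :: "nat \<Rightarrow> 'a list \<Rightarrow> bool" where
  "periodic T z \<longleftrightarrow> T \<ge> 1 \<and> length z \<ge> T + 1 \<and> (\<forall>i < length z - T. z ! i = z ! (i + T))"

text \<open>Meaningful only if \<open>z\<close> has some period.\<close>
definition min_period :: "'a list \<Rightarrow> nat" where
  "min_period z = (LEAST T. periodic T z)"

definition maximal_periodic_substring :: "nat \<Rightarrow> 'a list \<Rightarrow> nat \<times> nat \<Rightarrow> bool" where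
  "maximal_periodic_substring T z = (\<lambda>(a, b).
     a \<le> b \<and> b \<le> length z \<and> periodic T (substr z (a, b)) \<and>
     \<not> (\<exists>a' b'. a' \<le> a \<and> b \<le> b' \<and> b' \<le> length z \<and> b - a < b' - a' \<and>
              periodic T (substr z (a', b'))))"

text \<open>Neither \<open>t - s\<close> nor \<open>l - 1 - s\<close> is truncated, since \<open>s < min (l - 1) t\<close>.\<close>
definition check_pattern :: "nat \<Rightarrow> nat \<Rightarrow> nat \<Rightarrow> 'a list \<Rightarrow> nat \<times> nat \<Rightarrow> bool" where
  "check_pattern l t s z p \<longleftrightarrow>
     s < min (l - 1) t \<and>
     (\<exists>T. T \<le> t - s \<and>
          maximal_periodic_substring T z p \<and> min_period (substr z p) = T \<and>
          length (substr z p) \<ge> l - 1 - s)"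

definition le_check_pattern :: "nat \<Rightarrow> nat \<Rightarrow> nat \<Rightarrow> 'a list \<Rightarrow> nat \<times> nat \<Rightarrow> bool" where
  "le_check_pattern l t k z p \<longleftrightarrow> (\<exists>s' \<le> k. check_pattern l t s' z p)"

text \<open>\<open>List.product\<close> enumerates lexicographically, so the patterns are listed from left to right.\<close>
definition le_check_patterns :: "nat \<Rightarrow> nat \<Rightarrow> nat \<Rightarrow> 'a list \<Rightarrow> (nat \<times> nat) list" where
  "le_check_patterns l t k z =
     filter (le_check_pattern l t k z) (List.product [0..<Suc (length z)] [0..<Suc (length z)])"

text \<open>A single burst of deletions whose length is a positive multiple of \<open>T\<close>.\<close>
inductive delete_burst :: "nat \<Rightarrow> 'a list \<Rightarrow> 'a list \<Rightarrow> bool" for T where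
  "b \<noteq> [] \<Longrightarrow> T dvd length b \<Longrightarrow> delete_burst T (a @ b @ c) (a @ c)"

definition delete_min_periods :: "'a list \<Rightarrow> 'a list \<Rightarrow> bool" where
  "delete_min_periods p p' \<longleftrightarrow> (delete_burst (min_period p))\<^sup>+\<^sup>+ p p'"

end

theory Submission
  imports Defs "HOL-Library.Product_Lexorder"
begin

text \<open>
  By minimality of \<open>s\<close>, each gap of deleted reads is refilled with at most as many reads as it had.
  Refilling a gap of \<open>g\<close> reads with \<open>h < g\<close> reads cuts \<open>m = g - h\<close> letters out of the sequence, and
  consistency forces the cut to lie in an \<open>m\<close>-periodic factor of which at least \<open>l - 1 - s\<close> letters
  remain. Its minimum period \<open>T\<close> divides \<open>m\<close>, so complete periods of an \<open>(l, t, s)\<close>-check pattern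
  \<open>P\<close> are deleted. By Fine and Wilf, two different maximal periodic substrings with minimum periods
  \<open>T\<close>, \<open>T'\<close> overlap in at most \<open>T + T' - 2\<close> letters. Since \<open>2 t \<le> l\<close>, this is less than what
  remains of \<open>P\<close> and less than the length of any other pattern, so every other pattern sticks out of
  \<open>P\<close> on one side and survives a cut made at the opposite end of \<open>P\<close>.
\<close>

section \<open>Periods and runs\<close>

text \<open>Index functions on half-open intervals let two sequences be compared at shifted
  positions without cutting out factors. The condition is vacuous when \<open>b <= a + T\<close>, so
  length bounds are stated separately where they matter.\<close>

definition seg_period :: "(nat \<Rightarrow> 'a) \<Rightarrow> nat \<Rightarrow> nat \<Rightarrow> nat \<Rightarrow> bool" where
  "seg_period f T a b \<longleftrightarrow> (\<forall>i \<ge> a. i + T < b \<longrightarrow> f i = f (i + T))"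

lemma seg_period_subset:
  "seg_period f T a b \<Longrightarrow> a \<le> c \<Longrightarrow> d \<le> b \<Longrightarrow> seg_period f T c d"
  by (auto simp: seg_period_def)

lemma seg_period_add_mult:
  assumes "seg_period f T a b" "a \<le> i" "i + k * T < b"
  shows "f i = f (i + k * T)"
  using assms(3)
proof (induction k)
  case (Suc k)
  then have "f i = f (i + k * T)" by simp
  also have "\<dots> = f (i + k * T + T)"
    using assms(1,2) Suc.prems by (auto simp: seg_period_def algebra_simps)
  finally show ?case by (simp add: algebra_simps)
qed simp

lemma seg_period_dvd:
  assumes "seg_period f T a b" "T dvd m"
  shows "seg_period f m a b"
  using assms seg_period_add_mult[OF assms(1)]
  by (auto simp: seg_period_def dvd_def mult.commute)

lemma seg_period_mod_eq:
  assumes "seg_period f T a b" "a \<le> i" "i < b" "a \<le> j" "j < b" "i mod T = j mod T"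
  shows "f i = f j"
  using assms
proof (induction i j rule: linorder_wlog)
  case (le i j)
  then obtain k where "j = i + T * k" by (metis mod_eq_nat2E)
  then show ?case using seg_period_add_mult[of f T a b i k] le by (simp add: mult.commute)
qed metis

lemma ex_mod_eq_in_window:
  assumes "0 < (T :: nat)"
  shows "\<exists>j. c \<le> j \<and> j < c + T \<and> j mod T = i mod T"
proof -
  have "c mod T \<le> T" using assms by (simp add: less_imp_le)
  \<comment> \<open>The residue of \<open>i\<close> is reached from \<open>c\<close> by first
    completing \<open>c\<close> to a multiple of \<open>T\<close>; reducing the step modulo
    \<open>T\<close> keeps it inside the window.\<close>
  then have "(c + (T - c mod T)) mod T = 0"
    by (metis add.commute le_add_diff_inverse2 mod_add_left_eq mod_self)
  then have "(c + (i + (T - c mod T)) mod T) mod T = i mod T"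
    by (metis (no_types, lifting) add.left_commute add.right_neutral mod_add_right_eq)
  then show ?thesis
    using assms by (intro exI[of _ "c + (i + (T - c mod T)) mod T"]) auto
qed

text \<open>A window of \<open>T\<close> letters meets every residue class modulo \<open>T\<close>.
  So both \<open>i\<close> and \<open>i + g\<close> can be moved into \<open>[c, d)\<close> by
  multiples of \<open>T\<close>, and their images there are congruent modulo \<open>g\<close>
  because \<open>g dvd T\<close>.\<close>

lemma seg_period_extend:
  assumes T: "seg_period f T a b" "0 < T" and g: "seg_period f g c d" "g dvd T"
    and "a \<le> c" "d \<le> b" "c + T \<le> d"
  shows "seg_period f g a b"
  unfolding seg_period_def
proof (intro allI impI)
  fix i assume i: "a \<le> i" "i + g < b"
  obtain j where j: "c \<le> j" "j < c + T" "j mod T = i mod T"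
    using ex_mod_eq_in_window[OF T(2)] by blast
  obtain k where k: "c \<le> k" "k < c + T" "k mod T = (i + g) mod T"
    using ex_mod_eq_in_window[OF T(2)] by blast
  have "j mod g = k mod g"
    using j(3) k(3) g(2) by (metis mod_add_self2 mod_mod_cancel)
  then have "f j = f k"
    using g(1) j k assms by (intro seg_period_mod_eq[of f g c d]) auto
  moreover have "f i = f j" "f (i + g) = f k"
    using T i j k assms by (auto intro!: seg_period_mod_eq[of f T a b])
  ultimately show "f i = f (i + g)" by simp
qed

text \<open>Euclid's algorithm by subtraction: the smaller period \<open>p'\<close> and the
  difference \<open>q' - p'\<close> are periods of the interval shortened by \<open>p'\<close>
  letters. The gcd found there is carried back to the full interval by
  \<open>seg_period_extend\<close>.\<close>

lemma fine_wilf: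
  assumes "0 < p" "0 < q" "seg_period f p a b" "seg_period f q a b" "a + p + q \<le> b + gcd p q"
  shows "seg_period f (gcd p q) a b"
  using assms
proof (induction "p + q" arbitrary: p q b rule: less_induct)
  case less
  have main: "seg_period f (gcd p' q') a b"
    if "0 < p'" "p' < q'" "seg_period f p' a b" "seg_period f q' a b"
      "a + p' + q' \<le> b + gcd p' q'" "p' + q' = p + q" for p' q'
  proof -
    have gcd: "gcd p' (q' - p') = gcd p' q'"
      using gcd_diff1_nat[of p' q'] that(2) by (simp add: gcd.commute)
    \<comment> \<open>With the length hypothesis, this bound leaves at least \<open>p'\<close>
      letters in the shortened interval, as the extension requires.\<close>
    have "gcd p' q' \<le> q' - p'"
      using gcd_le2_nat[of "q' - p'" p'] that(2) unfolding gcd by simp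
    have "seg_period f (gcd p' (q' - p')) a (b - p')"
    proof (rule less.hyps)
      show "seg_period f (q' - p') a (b - p')"
        unfolding seg_period_def
      proof (intro allI impI)
        fix i assume i: "a \<le> i" "i + (q' - p') < b - p'"
        then have "f i = f (i + q')" "f (i + (q' - p')) = f (i + (q' - p') + p')"
          using that(1-4) by (auto simp: seg_period_def)
        then show "f i = f (i + (q' - p'))" using that by simp
      qed
      show "seg_period f p' a (b - p')"
        using that(3) by (rule seg_period_subset) auto
    qed (use that gcd in auto)
    then show ?thesis
      using that gcd \<open>gcd p' q' \<le> q' - p'\<close>
      by (intro seg_period_extend[of f p' a b "gcd p' q'" a "b - p'"]) auto
  qed
  consider "p = q" | "p < q" | "q < p" by linarith
  then show ?case
  proof cases
    case 1
    then show ?thesis using less.prems by simp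
  next
    case 2
    then show ?thesis using main less.prems by blast
  next
    case 3
    then show ?thesis using main[of q p] less.prems by (simp add: gcd.commute add.commute)
  qed
qed

text \<open>\<open>f\<close> stands for a sequence of length \<open>N\<close>, and \<open>T\<close> is the minimum period.\<close>
definition run :: "(nat \<Rightarrow> 'a) \<Rightarrow> nat \<Rightarrow> nat \<Rightarrow> nat \<Rightarrow> nat \<Rightarrow> bool" where
  "run f N T a b \<longleftrightarrow> 0 < T \<and> a + T < b \<and> b \<le> N \<and> seg_period f T a b \<and>
     (\<forall>T'. 0 < T' \<longrightarrow> T' < T \<longrightarrow> \<not> seg_period f T' a b) \<and>
     (a = 0 \<or> f (a - 1) \<noteq> f (a - 1 + T)) \<and> (b = N \<or> f b \<noteq> f (b - T))"

text \<open>If \<open>c\<close> exceeded \<open>a\<close>, then \<open>c - 1\<close> and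
  \<open>c - 1 + T\<close> would both lie in the first run, so the second run could be extended to
  the left.\<close>

lemma run_left_end_le:
  assumes "run f N T a b" "run f N T c e" "c + T \<le> b"
  shows "c \<le> a"
proof (rule ccontr)
  assume "\<not> c \<le> a"
  then have "a \<le> c - 1" "c - 1 + T < b" "c \<noteq> 0" using assms(3) by auto
  moreover have "seg_period f T a b" using assms(1) by (simp add: run_def)
  ultimately have "f (c - 1) = f (c - 1 + T)" by (simp add: seg_period_def)
  then show False using assms(2) \<open>c \<noteq> 0\<close> by (simp add: run_def)
qed

lemma run_right_end_ge:
  assumes "run f N T a b" "run f N T c e" "a + T \<le> e"
  shows "b \<le> e"
proof (rule ccontr)
  assume "\<not> b \<le> e"
  then have "a \<le> e - T" "e - T + T < b" "e - T + T = e" using assms(3) by auto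
  moreover have "seg_period f T a b" using assms(1) by (simp add: run_def)
  ultimately have "f (e - T) = f e" unfolding seg_period_def by metis
  moreover have "e \<noteq> N" using assms(1) \<open>\<not> b \<le> e\<close> by (auto simp: run_def)
  ultimately show False using assms(2) by (simp add: run_def)
qed

text \<open>Fine and Wilf give the overlap the period \<open>gcd T T'\<close>. The overlap contains
  a full period of each run, so this period spreads to both, and minimality forces
  \<open>T = T'\<close>. Runs of equal period that share a full period coincide by
  maximality.\<close>

lemma run_eq_if_overlap:
  assumes P: "run f N T a b" and Q: "run f N T' c e"
    and ov: "max a c + T + T' \<le> min b e + 1"
  shows "a = c \<and> b = e"
proof -
  define x y where "x = max a c" and "y = min b e"
  have xy: "a \<le> x" "c \<le> x" "y \<le> b" "y \<le> e" "x + T + T' \<le> y + 1"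
    using ov by (auto simp: x_def y_def)
  have pos: "0 < T" "0 < T'" using P Q by (simp_all add: run_def)
  have per: "seg_period f T a b" "seg_period f T' c e" using P Q by (simp_all add: run_def)
  have gpos: "0 < gcd T T'" using pos by simp
  have g: "seg_period f (gcd T T') x y"
  proof (rule fine_wilf)
    show "seg_period f T x y" using per(1) xy(1,3) by (rule seg_period_subset)
    show "seg_period f T' x y" using per(2) xy(2,4) by (rule seg_period_subset)
    show "x + T + T' \<le> y + gcd T T'" using xy gpos by linarith
  qed (use pos in auto)
  have wins: "x + T \<le> y" "x + T' \<le> y" using xy(5) pos by linarith+
  have "seg_period f (gcd T T') a b"
    using seg_period_extend[OF per(1) pos(1) g gcd_dvd1 xy(1,3) wins(1)] .
  then have "\<not> gcd T T' < T" using P gpos unfolding run_def by blast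
  moreover have "seg_period f (gcd T T') c e"
    using seg_period_extend[OF per(2) pos(2) g gcd_dvd2 xy(2,4) wins(2)] .
  then have "\<not> gcd T T' < T'" using Q gpos unfolding run_def by blast
  moreover have "gcd T T' \<le> T" "gcd T T' \<le> T'"
    using pos by (simp_all add: gcd_le1_nat gcd_le2_nat)
  ultimately have Q': "run f N T c e" using Q by simp
  have le: "c + T \<le> b" "a + T \<le> b" "a + T \<le> e" "c + T \<le> e" using wins xy by linarith+
  show ?thesis
    using run_left_end_le[OF P Q' le(1)] run_left_end_le[OF Q' P le(3)]
      run_right_end_ge[OF P Q' le(3)] run_right_end_ge[OF Q' P le(1)] by simp
qed

section \<open>Runs of sequences that agree on a prefix or, after a shift, on a suffix\<close>

lemma run_cong_prefix:
  assumes "\<And>i. i \<le> e \<Longrightarrow> f i = g i" "e < N" "e < M"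
  shows "run f N T c e = run g M T c e"
proof -
  have "seg_period f T c e = seg_period g T c e" for T
    using assms(1) by (auto simp: seg_period_def)
  then show ?thesis
    using assms by (cases "0 < T \<and> c + T < e") (auto simp: run_def)
qed

text \<open>The left maximality test reads the letter at \<open>c - 1\<close>, hence agreement from
  there on, written \<open>c <= i + 1\<close> to avoid truncation. With \<open>0 < c\<close> neither
  run starts at the beginning of its sequence, so this test is a letter comparison on both
  sides.\<close>

lemma run_cong_suffix:
  assumes "\<And>i. c \<le> i + 1 \<Longrightarrow> i < N \<Longrightarrow> g i = f (i + m)" "0 < c"
  shows "run f (N + m) T (c + m) (e + m) = run g N T c e"
proof (cases "0 < T \<and> c + T < e \<and> e \<le> N")
  case True
  have per: "seg_period f T (c + m) (e + m) = seg_period g T c e" for T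
  proof
    assume L: "seg_period f T (c + m) (e + m)"
    show "seg_period g T c e"
      unfolding seg_period_def
    proof (intro allI impI)
      fix i assume "c \<le> i" "i + T < e"
      then show "g i = g (i + T)"
        using L True assms(1)[of i] assms(1)[of "i + T"]
        by (auto simp: seg_period_def add.commute add.left_commute)
    qed
  next
    assume L: "seg_period g T c e"
    show "seg_period f T (c + m) (e + m)"
      unfolding seg_period_def
    proof (intro allI impI)
      fix i assume i: "c + m \<le> i" "i + T < e + m"
      then have "g (i - m) = g (i - m + T)"
        using L by (auto simp: seg_period_def)
      then show "f i = f (i + T)"
        using True i assms(1)[of "i - m"] assms(1)[of "i - m + T"] by auto
    qed
  qed
  have "g (c - 1) = f (c + m - 1)" "g (c - 1 + T) = f (c + m - 1 + T)"
    using True assms(1)[of "c - 1"] assms(1)[of "c - 1 + T"] assms(2) by (auto simp: algebra_simps)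
  moreover have "g e = f (e + m)" if "e \<noteq> N"
    using True assms(1)[of e] that by auto
  moreover have "g (e - T) = f (e + m - T)"
    using True assms(1)[of "e - T"] by auto
  ultimately show ?thesis
    using True assms(2) per by (auto simp: run_def)
qed (auto simp: run_def)

text \<open>In any other position the overlap is all of one run, or all of the first run except at
  most \<open>m\<close> letters. Either way it has at least \<open>T + T' - 1\<close> letters by
  \<open>2 * t <= l\<close>, so the runs coincide. Here \<open>m\<close> is the number of letters
  that the first run is about to lose.\<close>

lemma run_trichotomy:
  fixes l t s m :: nat
  assumes P: "run f N T a b" "T + s \<le> t" "l + m \<le> b - a + 1 + s"
    and Q: "run f N T' c e" "T' \<le> t" "l + T' \<le> e - c + 1 + t"
    and lt: "2 * t \<le> l" "t + 2 \<le> l"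
  shows "(c = a \<and> e = b) \<or> (c < a \<and> e + m < b) \<or> (a + m < c \<and> b < e)"
proof (rule ccontr)
  assume neg: "\<not> ?thesis"
  have "a < b" "c < e" using P Q by (auto simp: run_def)
  then have "max a c + T + T' \<le> min b e + 1"
    using P(2,3) Q(2,3) lt neg by linarith
  then show False using run_eq_if_overlap[OF P(1) Q(1)] neg by auto
qed

section \<open>Check patterns as runs\<close>

lemma periodic_substr_iff:
  assumes "b \<le> length z"
  shows "periodic T (substr z (a, b)) \<longleftrightarrow> 0 < T \<and> a + T < b \<and> seg_period ((!) z) T a b"
proof -
  have "(\<forall>i < (b - a) - T. z ! (a + i) = z ! (a + (i + T))) \<longleftrightarrow> seg_period ((!) z) T a b"
    if "a + T < b"
  proof
    assume L: "\<forall>i < (b - a) - T. z ! (a + i) = z ! (a + (i + T))"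
    show "seg_period ((!) z) T a b"
      unfolding seg_period_def
    proof (intro allI impI)
      fix i assume "a \<le> i" "i + T < b"
      then show "z ! i = z ! (i + T)" using L[rule_format, of "i - a"] by auto
    qed
  qed (auto simp: seg_period_def add.assoc[symmetric])
  moreover have "length (substr z (a, b)) = b - a"
    using assms by (auto simp: substr_def)
  moreover have "substr z (a, b) ! i = z ! (a + i)" if "i < b - a" for i
    using that assms by (auto simp: substr_def)
  ultimately show ?thesis
    by (auto simp: periodic_def)
qed

lemma min_period_substr_eq_iff:
  assumes "b \<le> length z" "periodic T0 (substr z (a, b))"
  shows "min_period (substr z (a, b)) = T \<longleftrightarrow>
    0 < T \<and> a + T < b \<and> seg_period ((!) z) T a b \<and>
    (\<forall>T'. 0 < T' \<longrightarrow> T' < T \<longrightarrow> \<not> seg_period ((!) z) T' a b)"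
    (is "?M = T \<longleftrightarrow> ?R")
proof
  assume T: "?M = T"
  have "periodic T (substr z (a, b))"
    using LeastI[of "\<lambda>T. periodic T (substr z (a, b))", OF assms(2)] T
    by (simp add: min_period_def)
  moreover have "\<not> periodic T' (substr z (a, b))" if "T' < T" for T'
    using that not_less_Least T unfolding min_period_def by blast
  ultimately show ?R
    using assms(1) by (auto simp: periodic_substr_iff)
next
  assume R: ?R
  show "?M = T"
    unfolding min_period_def
  proof (rule Least_equality)
    show "T \<le> T'" if "periodic T' (substr z (a, b))" for T'
      using R that assms(1) by (meson not_less periodic_substr_iff)
  qed (use R assms(1) in \<open>auto simp: periodic_substr_iff\<close>)
qed

lemma seg_period_Suc_left:
  assumes "seg_period f T (Suc a) b" "f a = f (a + T)"
  shows "seg_period f T a b"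
  unfolding seg_period_def
proof (intro allI impI)
  fix i assume "a \<le> i" "i + T < b"
  then show "f i = f (i + T)"
    using assms by (cases "i = a") (simp_all add: seg_period_def)
qed

lemma seg_period_Suc_right:
  assumes "seg_period f T a b" "f (b - T) = f b"
  shows "seg_period f T a (Suc b)"
  unfolding seg_period_def
proof (intro allI impI)
  fix i assume i: "a \<le> i" "i + T < Suc b"
  show "f i = f (i + T)"
  proof (cases "i + T = b")
    case True
    then have "i = b - T" by simp
    then show ?thesis using assms(2) True by simp
  qed (use i assms(1) in \<open>simp add: seg_period_def\<close>)
qed

text \<open>A proper extension with period \<open>T\<close> restricts to an extension by a single
  letter, so maximality reduces to testing the two neighbouring letters.\<close>

lemma maximal_periodic_substring_iff:
  "maximal_periodic_substring T z (a, b) \<longleftrightarrow>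
     0 < T \<and> a + T < b \<and> b \<le> length z \<and> seg_period ((!) z) T a b \<and>
     (a = 0 \<or> z ! (a - 1) \<noteq> z ! (a - 1 + T)) \<and> (b = length z \<or> z ! b \<noteq> z ! (b - T))"
proof (cases "0 < T \<and> a + T < b \<and> b \<le> length z \<and> seg_period ((!) z) T a b")
  case True
  then have ab: "0 < T" "a + T < b" "b \<le> length z" and per: "seg_period ((!) z) T a b"
    by blast+
  let ?ext = "\<lambda>a' b'. a' \<le> a \<and> b \<le> b' \<and> b' \<le> length z \<and> b - a < b' - a' \<and>
    seg_period ((!) z) T a' b'"
  have "periodic T (substr z (a', b')) \<longleftrightarrow> seg_period ((!) z) T a' b'"
    if "a' \<le> a" "b \<le> b'" "b' \<le> length z" for a' b'
    using that ab periodic_substr_iff[of b' z T a'] by linarith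
  moreover have "periodic T (substr z (a, b))"
    using ab per periodic_substr_iff[of b z T a] by blast
  moreover have "a \<le> b" using ab by linarith
  ultimately have L: "maximal_periodic_substring T z (a, b) \<longleftrightarrow> (\<nexists>a' b'. ?ext a' b')"
    using ab(3) unfolding maximal_periodic_substring_def prod.case by blast
  have left: "z ! (a - 1) = z ! (a - 1 + T)" "a \<noteq> 0" if "?ext a' b'" "a' < a" for a' b'
  proof -
    have "a' \<le> a - 1" "a - 1 + T < b'" using that ab by auto
    then show "z ! (a - 1) = z ! (a - 1 + T)" using that(1) by (auto simp: seg_period_def)
  qed (use that(2) in simp)
  have right: "z ! b = z ! (b - T)" "b \<noteq> length z" if "?ext a' b'" "b < b'" for a' b'
  proof -
    have "a' \<le> b - T" "b - T + T < b'" "b - T + T = b" using that ab by auto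
    then show "z ! b = z ! (b - T)" using that(1) unfolding seg_period_def by metis
  qed (use that in simp)
  have left': "?ext (a - 1) b" if "a \<noteq> 0" "z ! (a - 1) = z ! (a - 1 + T)"
    using seg_period_Suc_left[of "(!) z" T "a - 1" b] that per ab by auto
  have right': "?ext a (Suc b)" if "b \<noteq> length z" "z ! b = z ! (b - T)"
    using seg_period_Suc_right[of "(!) z" T a b] that per ab by auto
  have "(\<nexists>a' b'. ?ext a' b') \<longleftrightarrow>
    (a = 0 \<or> z ! (a - 1) \<noteq> z ! (a - 1 + T)) \<and> (b = length z \<or> z ! b \<noteq> z ! (b - T))"
  proof
    assume "\<nexists>a' b'. ?ext a' b'"
    then show "(a = 0 \<or> z ! (a - 1) \<noteq> z ! (a - 1 + T)) \<and> (b = length z \<or> z ! b \<noteq> z ! (b - T))"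
      using left' right' by blast
  next
    assume max: "(a = 0 \<or> z ! (a - 1) \<noteq> z ! (a - 1 + T)) \<and> (b = length z \<or> z ! b \<noteq> z ! (b - T))"
    have False if "?ext a' b'" for a' b'
    proof -
      have "a' < a \<or> b < b'" using that by linarith
      then show False using left[OF that] right[OF that] max by blast
    qed
    then show "\<nexists>a' b'. ?ext a' b'" by blast
  qed
  then show ?thesis using True unfolding L by blast
next
  case False
  then have "\<not> maximal_periodic_substring T z (a, b)"
    unfolding maximal_periodic_substring_def prod.case using periodic_substr_iff[of b z T a] by blast
  then show ?thesis using False by blast
qed

lemma maximal_min_periodic_iff_run:
  "maximal_periodic_substring T z (a, b) \<and> min_period (substr z (a, b)) = T \<longleftrightarrow>
     run ((!) z) (length z) T a b"
proof (cases "maximal_periodic_substring T z (a, b)")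
  case True
  then have "b \<le> length z" "periodic T (substr z (a, b))"
    unfolding maximal_periodic_substring_def by blast+
  from min_period_substr_eq_iff[OF this, of T] show ?thesis
    using True unfolding run_def maximal_periodic_substring_iff by blast
next
  case False
  then show ?thesis unfolding run_def maximal_periodic_substring_iff by blast
qed

lemma check_pattern_iff_run:
  "check_pattern l t s z (a, b) \<longleftrightarrow> s < min (l - 1) t \<and>
     (\<exists>T. T + s \<le> t \<and> l \<le> b - a + 1 + s \<and> run ((!) z) (length z) T a b)"
proof -
  have "T \<le> t - s \<and> maximal_periodic_substring T z (a, b) \<and> min_period (substr z (a, b)) = T \<and>
      l - 1 - s \<le> length (substr z (a, b)) \<longleftrightarrow>
    T + s \<le> t \<and> l \<le> b - a + 1 + s \<and> run ((!) z) (length z) T a b"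
    if "s < min (l - 1) t" for T
  proof (cases "run ((!) z) (length z) T a b")
    case True
    then have "length (substr z (a, b)) = b - a" by (auto simp: run_def substr_def)
    then have "l - 1 - s \<le> length (substr z (a, b)) \<longleftrightarrow> l \<le> b - a + 1 + s"
      by linarith
    moreover have "T \<le> t - s \<longleftrightarrow> T + s \<le> t" using that by linarith
    ultimately show ?thesis
      using True maximal_min_periodic_iff_run[of T z a b] by blast
  next
    case False
    then show ?thesis using maximal_min_periodic_iff_run[of T z a b] by blast
  qed
  then show ?thesis unfolding check_pattern_def by blast
qed

text \<open>The best choice of \<open>s'\<close> for a pattern with minimum period \<open>T\<close> is \<open>t - T\<close>.\<close>
lemma le_check_pattern_iff_run:
  assumes "1 \<le> t" "t + 2 \<le> l"
  shows "le_check_pattern l t (t - 1) z (a, b) \<longleftrightarrow>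
    (\<exists>T \<le> t. l + T \<le> b - a + 1 + t \<and> run ((!) z) (length z) T a b)"
proof
  assume "le_check_pattern l t (t - 1) z (a, b)"
  then obtain s where "check_pattern l t s z (a, b)"
    unfolding le_check_pattern_def by blast
  then obtain T where "T + s \<le> t" "l \<le> b - a + 1 + s" "run ((!) z) (length z) T a b"
    unfolding check_pattern_iff_run by blast
  moreover from this have "T \<le> t" "l + T \<le> b - a + 1 + t" by linarith+
  ultimately show "\<exists>T \<le> t. l + T \<le> b - a + 1 + t \<and> run ((!) z) (length z) T a b"
    by blast
next
  assume "\<exists>T \<le> t. l + T \<le> b - a + 1 + t \<and> run ((!) z) (length z) T a b"
  then obtain T where T: "T \<le> t" "l + T \<le> b - a + 1 + t" "run ((!) z) (length z) T a b"
    by blast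
  then have "0 < T" by (simp add: run_def)
  then have "t - T < min (l - 1) t" "T + (t - T) \<le> t" "l \<le> b - a + 1 + (t - T)" "t - T \<le> t - 1"
    using T assms by linarith+
  moreover from this have "check_pattern l t (t - T) z (a, b)"
    unfolding check_pattern_iff_run using T(3) by blast
  ultimately show "le_check_pattern l t (t - 1) z (a, b)"
    unfolding le_check_pattern_def by blast
qed

lemma min_period_substr_run:
  "run ((!) z) (length z) T a b \<Longrightarrow> min_period (substr z (a, b)) = T"
  using maximal_min_periodic_iff_run by blast

text \<open>Among the listed patterns, the stronger property depends only on minimum period and
  length. It can therefore be compared between sequences in which the pattern sits at different
  positions.\<close>

lemma check_pattern_iff_le_check_pattern:
  assumes "s < t" "t + 2 \<le> l"
  shows "check_pattern l t s z p \<longleftrightarrow> le_check_pattern l t (t - 1) z p \<and>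
    min_period (substr z p) + s \<le> t \<and> l \<le> length (substr z p) + 1 + s"
proof (cases p)
  case (Pair a b)
  have len: "length (substr z (a, b)) = b - a" if "b \<le> length z"
    using that by (auto simp: substr_def)
  have "check_pattern l t s z (a, b)" if "le_check_pattern l t (t - 1) z (a, b)"
    "min_period (substr z (a, b)) + s \<le> t" "l \<le> length (substr z (a, b)) + 1 + s"
  proof -
    obtain T where "run ((!) z) (length z) T a b"
      using \<open>le_check_pattern _ _ _ _ _\<close> assms le_check_pattern_iff_run[of t l z a b]
      by (auto simp del: One_nat_def)
    moreover from this have "b \<le> length z" by (simp add: run_def)
    ultimately show ?thesis
      using that assms len min_period_substr_run[of z T a b] by (auto simp: check_pattern_iff_run)
  qed
  moreover have "le_check_pattern l t (t - 1) z (a, b) \<and>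
    min_period (substr z (a, b)) + s \<le> t \<and> l \<le> length (substr z (a, b)) + 1 + s"
    if cp: "check_pattern l t s z (a, b)"
  proof -
    obtain T where T: "T + s \<le> t" "l \<le> b - a + 1 + s" "run ((!) z) (length z) T a b"
      using cp by (auto simp: check_pattern_iff_run)
    moreover from T have "b \<le> length z" by (simp add: run_def)
    moreover have "le_check_pattern l t (t - 1) z (a, b)"
      using cp assms unfolding le_check_pattern_def by (intro exI[of _ s]) auto
    ultimately show ?thesis
      using len min_period_substr_run[of z T a b] by auto
  qed
  ultimately show ?thesis unfolding Pair by blast
qed

section \<open>The list of check patterns from left to right\<close>

lemma sorted_wrt_less_product:
  fixes xs :: "'a :: linorder list" and ys :: "'b :: linorder list"
  assumes "sorted_wrt (<) xs" "sorted_wrt (<) ys"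
  shows "sorted_wrt (<) (List.product xs ys)"
  using assms by (induction xs) (auto simp: sorted_wrt_append sorted_wrt_map less_prod_simp)

lemma set_le_check_patterns:
  assumes "1 \<le> t" "t + 2 \<le> l"
  shows "set (le_check_patterns l t (t - 1) z) = {p. le_check_pattern l t (t - 1) z p}"
proof -
  have "a \<le> length z \<and> b \<le> length z" if "le_check_pattern l t (t - 1) z (a, b)" for a b
    using that assms le_check_pattern_iff_run[of t l z a b] by (auto simp: run_def)
  then show ?thesis
    by (fastforce simp: le_check_patterns_def)
qed

text \<open>A strictly sorted list is determined by its set. Matching the \<open>i\<close>-th
  patterns of two sequences thus reduces to finding an increasing bijection between the pattern
  sets.\<close>

lemma sorted_le_check_patterns:
  "sorted_wrt (<) (le_check_patterns l t k z)"
  unfolding le_check_patterns_def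
  by (intro sorted_wrt_filter sorted_wrt_less_product) (simp_all only: sorted_wrt_upt)

text \<open>Extend by one letter on either side as long as a test permits; the number of letters
  outside the interval decreases.\<close>

lemma ex_maximal_extension:
  assumes "seg_period f T c d" "c \<le> d" "d \<le> N"
  shows "\<exists>a b. a \<le> c \<and> d \<le> b \<and> b \<le> N \<and> seg_period f T a b \<and>
    (a = 0 \<or> f (a - 1) \<noteq> f (a - 1 + T)) \<and> (b = N \<or> f b \<noteq> f (b - T))"
  using assms
proof (induction "c + (N - d)" arbitrary: c d rule: less_induct)
  case less
  show ?case
  proof (cases "c \<noteq> 0 \<and> f (c - 1) = f (c - 1 + T)")
    case True
    then have "seg_period f T (c - 1) d"
      using less.prems(1) seg_period_Suc_left[of f T "c - 1" d] by simp
    moreover have "c - 1 + (N - d) < c + (N - d)" "c - 1 \<le> d" using True less.prems by linarith+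
    ultimately obtain a b where "a \<le> c - 1" and b: "d \<le> b \<and> b \<le> N \<and> seg_period f T a b \<and>
      (a = 0 \<or> f (a - 1) \<noteq> f (a - 1 + T)) \<and> (b = N \<or> f b \<noteq> f (b - T))"
      using less.hyps[of "c - 1" d] less.prems(3) by blast
    then have "a \<le> c" by linarith
    then show ?thesis using b by blast
  next
    case left: False
    show ?thesis
    proof (cases "d \<noteq> N \<and> f d = f (d - T)")
      case True
      then have "seg_period f T c (Suc d)"
        using less.prems(1) seg_period_Suc_right[of f T c d] by simp
      moreover have "c + (N - Suc d) < c + (N - d)" "c \<le> Suc d" "Suc d \<le> N"
        using True less.prems by linarith+
      ultimately obtain a b where "Suc d \<le> b" and b: "a \<le> c \<and> b \<le> N \<and> seg_period f T a b \<and>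
        (a = 0 \<or> f (a - 1) \<noteq> f (a - 1 + T)) \<and> (b = N \<or> f b \<noteq> f (b - T))"
        using less.hyps[of c "Suc d"] by blast
      then have "d \<le> b" by linarith
      then show ?thesis using b by blast
    next
      case False
      then have "d = N \<or> f d \<noteq> f (d - T)" "c = 0 \<or> f (c - 1) \<noteq> f (c - 1 + T)"
        using left by argo+
      then show ?thesis using less.prems order_refl[of c] order_refl[of d] by iprover
    qed
  qed
qed

section \<open>A single deletion\<close>

text \<open>Since \<open>U\<close> has period \<open>m\<close>, dropping its first \<open>m\<close>
  letters has the same effect as deleting any \<open>m\<close> consecutive letters of it. The bounds
  say that the periodic part keeps at least \<open>l - 1 - s\<close> letters and that
  \<open>m\<close> is at most \<open>t - s\<close>.\<close>

definition deletion_step :: "nat \<Rightarrow> nat \<Rightarrow> nat \<Rightarrow> 'a list \<Rightarrow> 'a list \<Rightarrow> bool" where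
  "deletion_step l t s z z' \<longleftrightarrow> (\<exists>A U B m. z = A @ U @ B \<and> z' = A @ drop m U @ B \<and>
     0 < m \<and> m + s \<le> t \<and> l + m \<le> length U + 1 + s \<and> seg_period ((!) U) m 0 (length U))"

lemma ex_min_seg_period:
  assumes "seg_period f m a b" "0 < m"
  obtains T where "0 < T" "T \<le> m" "seg_period f T a b"
    "\<And>T'. 0 < T' \<Longrightarrow> T' < T \<Longrightarrow> \<not> seg_period f T' a b"
proof -
  let ?P = "\<lambda>T. 0 < T \<and> seg_period f T a b"
  have "?P m" using assms by simp
  then have "?P (LEAST T. ?P T)" "(LEAST T. ?P T) \<le> m" by (rule LeastI, rule Least_le)
  moreover have "\<not> ?P T'" if "T' < (LEAST T. ?P T)" for T' using not_less_Least[OF that] .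
  ultimately show ?thesis using that by blast
qed

text \<open>The factor \<open>U\<close> lies in a maximal run \<open>[a, b + m)\<close> whose
  minimum period divides \<open>m\<close>. As \<open>m\<close> is a period of the run, the cut can
  be placed at either end of it. This gives the last two conclusions, one for each placement, which
  overlap on \<open>[a, b)\<close>.\<close>

lemma deletion_step_runs:
  assumes step: "deletion_step l t s z z'"
    and st: "s < t" and tl: "t + 2 \<le> l" "2 * t \<le> l"
  obtains T a b m where
    "run ((!) z) (length z) T a (b + m)" "run ((!) z') (length z') T a b"
    "T dvd m" "0 < m" "T + s \<le> t" "l \<le> b - a + 1 + s" "a < b"
    "length z = length z' + m"
    "\<And>i. i < b \<Longrightarrow> z' ! i = z ! i"
    "\<And>i. a \<le> i \<Longrightarrow> i < length z' \<Longrightarrow> z' ! i = z ! (i + m)"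
proof -
  obtain A U B m where z: "z = A @ U @ B" and z': "z' = A @ drop m U @ B"
    and m: "0 < m" "m + s \<le> t" and U: "l + m \<le> length U + 1 + s"
    and per: "seg_period ((!) U) m 0 (length U)"
    using step unfolding deletion_step_def by blast
  define u w where "u = length A" and "w = length A + length U"
  have zU: "z ! (u + i) = U ! i" if "i < length U" for i
    using that by (simp add: z u_def nth_append)
  have uw: "u + l + m \<le> w + 1 + s" "w \<le> length z" using U by (auto simp: u_def w_def z)
  have mU: "seg_period ((!) z) m u w"
    unfolding seg_period_def
  proof (intro allI impI)
    fix i assume i: "u \<le> i" "i + m < w"
    then have "U ! (i - u) = U ! (i - u + m)"
      using per by (auto simp: seg_period_def u_def w_def)
    then show "z ! i = z ! (i + m)"
      using i zU[of "i - u"] zU[of "i - u + m"] by (auto simp: u_def w_def)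
  qed
  obtain T where T: "0 < T" "T \<le> m" "seg_period ((!) z) T u w"
    and Tmin: "\<And>T'. 0 < T' \<Longrightarrow> T' < T \<Longrightarrow> \<not> seg_period ((!) z) T' u w"
    using ex_min_seg_period[OF mU m(1)] by metis
  \<comment> \<open>The factor has at least \<open>l - 1 - s + m\<close> letters, which suffices for
    Fine and Wilf with \<open>T\<close> and \<open>m\<close>; minimality of \<open>T\<close> then
    gives \<open>T dvd m\<close>.\<close>
  have "seg_period ((!) z) (gcd T m) u w"
    using fine_wilf[OF T(1) m(1) T(3) mU] uw m T(2) tl st by linarith
  then have "T \<le> gcd T m" using Tmin T(1) by (metis gcd_pos_nat not_less less_numeral_extra(3))
  then have Tm: "T dvd m" using T(1)
    by (metis dvd_antisym gcd_dvd1 gcd_dvd2 gcd_le1_nat le_antisym less_numeral_extra(3))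
  obtain a c where ac: "a \<le> u" "w \<le> c" "c \<le> length z" "seg_period ((!) z) T a c"
    and ac_max: "a = 0 \<or> z ! (a - 1) \<noteq> z ! (a - 1 + T)"
      "c = length z \<or> z ! c \<noteq> z ! (c - T)"
    using ex_maximal_extension[OF T(3) _ uw(2)] uw m st tl by fastforce
  define b where "b = c - m"
  have c: "c = b + m" and ab: "a + T + T \<le> b + 1" "a + T < b" "l \<le> b - a + 1 + s"
    using ac uw m T(2) st tl by (auto simp: b_def)
  have mac: "seg_period ((!) z) m a c" using seg_period_dvd[OF ac(4) Tm] .
  have len: "length z = length z' + m" using z z' uw m st tl by (auto simp: u_def w_def)
  have pre: "z' ! i = z ! i" if "i < u" for i
    using that by (simp add: z z' u_def nth_append)
  have suf: "z' ! i = z ! (i + m)" if "u \<le> i" "i < length z'" for i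
    using that U m st tl by (auto simp: z z' u_def nth_append add.commute)
  have left: "z' ! i = z ! i" if "i < b" for i
  proof (cases "i < u")
    case False
    then have "z ! i = z ! (i + m)"
      using mac that ac c by (auto simp: seg_period_def)
    then show ?thesis using False suf[of i] that c ac len by simp
  qed (rule pre)
  have right: "z' ! i = z ! (i + m)" if "a \<le> i" "i < length z'" for i
  proof (cases "i < u")
    case True
    then have "z ! i = z ! (i + m)"
      using mac that ac c uw st tl m by (auto simp: seg_period_def)
    then show ?thesis using True pre[of i] by simp
  qed (use suf that in simp)
  have Tab: "seg_period ((!) z) T a b" using ac(4) by (rule seg_period_subset) (auto simp: c)
  have min_ac: "\<not> seg_period ((!) z) T' a c" if "0 < T'" "T' < T" for T'
  proof
    assume "seg_period ((!) z) T' a c"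
    then have "seg_period ((!) z) T' u w" using ac(1,2) by (rule seg_period_subset)
    then show False using Tmin that by blast
  qed
  \<comment> \<open>A shorter run might admit smaller periods. But at least \<open>2 * T - 1\<close>
    letters remain, so a smaller period would combine with \<open>T\<close> by Fine and Wilf and
    spread back to the whole run \<open>[a, c)\<close>.\<close>
  have min_ab: "\<not> seg_period ((!) z) T' a b" if "0 < T'" "T' < T" for T'
  proof
    assume L: "seg_period ((!) z) T' a b"
    have "seg_period ((!) z) (gcd T T') a b"
      using fine_wilf[OF T(1) that(1) Tab L] ab that by linarith
    from seg_period_extend[OF ac(4) T(1) this gcd_dvd1 order_refl]
    have "seg_period ((!) z) (gcd T T') a c" using c ab by simp
    moreover have "0 < gcd T T'" "gcd T T' \<le> T'" using that T(1) by (auto intro: gcd_le2_nat)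
    ultimately show False using min_ac that by auto
  qed
  have eq: "seg_period ((!) z') d a b = seg_period ((!) z) d a b" for d
    using left by (auto simp: seg_period_def)
  show ?thesis
  proof (rule that)
    show "run ((!) z) (length z) T a (b + m)"
      using T ac ac_max ab c min_ac by (auto simp: run_def)
    have "z' ! (a - 1) = z ! (a - 1)" "z' ! (a - 1 + T) = z ! (a - 1 + T)"
      using left ab by simp_all
    moreover have "z' ! b = z ! c" "z' ! (b - T) = z ! (c - T)" if "c \<noteq> length z"
      using right[of b] right[of "b - T"] that ab c len ac by auto
    ultimately show "run ((!) z') (length z') T a b"
      using T ac ac_max ab c min_ab eq Tab len by (auto simp: run_def)
    show "T + s \<le> t" using T(2) m by simp
  qed (use Tm m ab len left right in auto)
qed

text \<open>The pattern starting at \<open>a\<close> is the one that loses \<open>m\<close> letters; \<open>b\<close> is its new end.\<close>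
definition relocate :: "nat \<Rightarrow> nat \<Rightarrow> nat \<Rightarrow> nat \<times> nat \<Rightarrow> nat \<times> nat" where
  "relocate a b m = (\<lambda>(c, e). if c < a then (c, e) else if c = a then (a, b) else (c - m, e - m))"

text \<open>The claim in a form that composes along successive deletions; \<open>list_all2\<close>
  also carries the equality of the counts.\<close>

definition patterns_preserved :: "nat \<Rightarrow> nat \<Rightarrow> nat \<Rightarrow> 'a list \<Rightarrow> 'a list \<Rightarrow> bool" where
  "patterns_preserved l t s z z' \<longleftrightarrow>
     list_all2 (\<lambda>p p'. min_period (substr z' p') = min_period (substr z p) \<and>
       (substr z' p' = substr z p \<or>
        check_pattern l t s z p \<and> delete_min_periods (substr z p) (substr z' p')))
       (le_check_patterns l t (t - 1) z) (le_check_patterns l t (t - 1) z')"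

section \<open>Composition of pattern-preserving changes\<close>

lemma delete_burst_length: "delete_burst T p p' \<Longrightarrow> length p' < length p"
  by (auto elim!: delete_burst.cases)

lemma delete_min_periods_length: "delete_min_periods p p' \<Longrightarrow> length p' \<le> length p"
proof -
  have "(delete_burst T)\<^sup>+\<^sup>+ p p' \<Longrightarrow> length p' < length p" for T
    by (induction rule: tranclp_induct) (auto dest: delete_burst_length)
  then show "delete_min_periods p p' \<Longrightarrow> length p' \<le> length p"
    unfolding delete_min_periods_def by fastforce
qed

lemma patterns_preserved_refl: "patterns_preserved l t s z z"
  by (auto simp: patterns_preserved_def intro: list.rel_refl)

lemma patterns_preserved_trans:
  assumes "patterns_preserved l t s z z'" "patterns_preserved l t s z' z''"
    and "s < t" "t + 2 \<le> l"
  shows "patterns_preserved l t s z z''"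
proof -
  let ?L = "le_check_patterns l t (t - 1)"
  let ?R = "\<lambda>z z' p p'. min_period (substr z' p') = min_period (substr z p) \<and>
       (substr z' p' = substr z p \<or>
        check_pattern l t s z p \<and> delete_min_periods (substr z p) (substr z' p'))"
  have len: "length (?L z) = length (?L z')" "length (?L z') = length (?L z'')"
    using assms by (auto simp: patterns_preserved_def dest: list_all2_lengthD)
  have "?R z z'' (?L z ! i) (?L z'' ! i)" if i: "i < length (?L z)" for i
  proof -
    let ?p = "?L z ! i" and ?p' = "?L z' ! i" and ?p'' = "?L z'' ! i"
    have R: "?R z z' ?p ?p'" "?R z' z'' ?p' ?p''"
      using assms(1,2) i len by (auto simp: patterns_preserved_def list_all2_conv_all_nth)
    have "?p \<in> set (?L z)" using i by simp
    then have "le_check_pattern l t (t - 1) z ?p"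
      using set_le_check_patterns[of t l z] assms(3,4) by auto
    moreover have "length (substr z' ?p') \<le> length (substr z ?p)"
      using R(1) delete_min_periods_length by (metis order_refl)
    \<comment> \<open>The pattern in \<open>z\<close> has the same minimum period as its partner in
      \<open>z'\<close> and is at least as long, so it inherits the check-pattern bounds.\<close>
    ultimately have cp: "check_pattern l t s z ?p" if "check_pattern l t s z' ?p'"
      using that R(1) check_pattern_iff_le_check_pattern[OF assms(3,4), of z ?p]
        check_pattern_iff_le_check_pattern[OF assms(3,4), of z' ?p'] by linarith
    have trans: "delete_min_periods (substr z ?p) (substr z'' ?p'')"
      if "delete_min_periods (substr z ?p) (substr z' ?p')"
        "delete_min_periods (substr z' ?p') (substr z'' ?p'')"
      using that conjunct1[OF R(1)] unfolding delete_min_periods_def by (auto intro: tranclp_trans)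
    show ?thesis
    proof
      show "min_period (substr z'' ?p'') = min_period (substr z ?p)" using R by simp
      show "substr z'' ?p'' = substr z ?p \<or>
        check_pattern l t s z ?p \<and> delete_min_periods (substr z ?p) (substr z'' ?p'')"
      proof (cases "substr z'' ?p'' = substr z' ?p'")
        case True
        then show ?thesis using conjunct2[OF R(1)] by simp
      next
        case False
        then have *: "check_pattern l t s z ?p" "delete_min_periods (substr z' ?p') (substr z'' ?p'')"
          using conjunct2[OF R(2)] cp by blast+
        show ?thesis
        proof (cases "substr z' ?p' = substr z ?p")
          case True
          then show ?thesis using * by simp
        next
          case False
          then show ?thesis using * conjunct2[OF R(1)] trans by blast
        qed
      qed
    qed
  qed
  then show ?thesis
    using len unfolding patterns_preserved_def list_all2_conv_all_nth by simp
qed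

text \<open>The map \<open>relocate a b m\<close> is an increasing bijection between the patterns of
  \<open>z\<close> and those of \<open>z'\<close>. A pattern to the left of the cut run is compared
  through the common prefix, one to the right through the shifted suffix; only the run itself loses
  letters.\<close>

lemma patterns_preserved_deletion_step:
  assumes step: "deletion_step l t s z z'"
    and st: "s < t" and tl: "t + 2 \<le> l" "2 * t \<le> l"
  shows "patterns_preserved l t s z z'"
proof -
  obtain T a b m where
    run: "run ((!) z) (length z) T a (b + m)" and run': "run ((!) z') (length z') T a b"
    and Tm: "T dvd m" "0 < m" and Ts: "T + s \<le> t" and lb: "l \<le> b - a + 1 + s" "a < b"
    and len: "length z = length z' + m"
    and left: "\<And>i. i < b \<Longrightarrow> z' ! i = z ! i"
    and right: "\<And>i. a \<le> i \<Longrightarrow> i < length z' \<Longrightarrow> z' ! i = z ! (i + m)"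
    using deletion_step_runs[OF step st tl] by metis
  have t1: "1 \<le> t" using st by simp
  have bound: "b \<le> length z'" "b + m \<le> length z" using run run' by (auto simp: run_def)
  note iff = le_check_pattern_iff_run[OF t1 tl(1)]
  let ?C = "le_check_pattern l t (t - 1)" and ?L = "le_check_patterns l t (t - 1)"
  let ?\<phi> = "relocate a b m"
  have P: "?C z (a, b + m)"
    unfolding iff using run Ts lb st by (intro exI[of _ T]) auto
  have P': "?C z' (a, b)"
    unfolding iff using run' Ts lb st by (intro exI[of _ T]) auto
  have tri: "(c, e) = (a, b + m) \<or> (c < a \<and> e < b) \<or> (a + m < c \<and> b + m < e)"
    if C: "?C z (c, e)" for c e
  proof -
    obtain T' where "T' \<le> t" "l + T' \<le> e - c + 1 + t" "run ((!) z) (length z) T' c e"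
      using C unfolding iff by blast
    from run_trichotomy[OF run Ts _ this(3,1,2) tl(2,1), of m]
    show ?thesis using lb by auto
  qed
  have tri': "(c, e) = (a, b) \<or> (c < a \<and> e < b) \<or> (a < c \<and> b < e)"
    if C: "?C z' (c, e)" for c e
  proof -
    obtain T' where "T' \<le> t" "l + T' \<le> e - c + 1 + t" "run ((!) z') (length z') T' c e"
      using C unfolding iff by blast
    \<comment> \<open>In \<open>z'\<close> the run is already shortened and loses nothing more,
      hence the value 0.\<close>
    from run_trichotomy[OF run' Ts _ this(3,1,2) tl(2,1), of 0]
    show ?thesis using lb by auto
  qed
  have C_left: "?C z (c, e) = ?C z' (c, e)" if "e < b" for c e
    using run_cong_prefix[of e "(!) z" "(!) z'" "length z" "length z'"] that left bound
    unfolding iff by simp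
  have C_right: "?C z (c + m, e + m) = ?C z' (c, e)" if "a < c" for c e
    using run_cong_suffix[of c "length z'" "(!) z'" "(!) z" m] that right
    unfolding iff len by simp
  have img: "?C z' (?\<phi> p)" if "?C z p" for p
  proof (cases p)
    case (Pair c e)
    then show ?thesis
      using tri[of c e] that P' C_left[of e c] C_right[of "c - m" "e - m"] lb
      by (auto simp: relocate_def)
  qed
  have pre: "\<exists>p. ?C z p \<and> ?\<phi> p = p'" if C: "?C z' p'" for p'
  proof (cases p')
    case (Pair c e)
    consider "(c, e) = (a, b)" | "c < a" "e < b" | "a < c" "b < e"
      using tri'[of c e] C unfolding Pair by blast
    then show ?thesis
    proof cases
      case 1
      then show ?thesis using P Pair by (intro exI[of _ "(a, b + m)"]) (auto simp: relocate_def)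
    next
      case 2
      then show ?thesis
        using C Pair C_left by (intro exI[of _ "(c, e)"]) (auto simp: relocate_def)
    next
      case 3
      then show ?thesis
        using C Pair C_right
        by (intro exI[of _ "(c + m, e + m)"]) (auto simp: relocate_def)
    qed
  qed
  have mono: "?\<phi> p < ?\<phi> p'" if "?C z p" "?C z p'" "p < p'" for p p'
  proof (cases p, cases p')
    fix c e c' e' assume p: "p = (c, e)" "p' = (c', e')"
    have lex: "c < c' \<or> c = c' \<and> e < e'" using \<open>p < p'\<close> unfolding p by auto
    have "c = a \<and> e = b + m \<or> c < a \<and> e < b \<or> a + m < c \<and> b + m < e"
      using tri[of c e] \<open>?C z p\<close> unfolding p by blast
    moreover have "c' = a \<and> e' = b + m \<or> c' < a \<and> e' < b \<or> a + m < c' \<and> b + m < e'"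
      using tri[of c' e'] \<open>?C z p'\<close> unfolding p by blast
    \<comment> \<open>Each pattern lies left of the run, is the run, or lies right of it; these are
      the combinations compatible with the lexicographic order.\<close>
    ultimately consider "c' < a" "c < a" | "c' = a" "c < a" | "a + m < c'" "c < a" | "a + m < c'" "c = a"
      | "a + m < c'" "a + m < c" "b + m < e" "b + m < e'"
      using lex by linarith
    then show ?thesis
    proof cases
      case 5
      then have "c - m < c' - m \<or> c - m = c' - m \<and> e - m < e' - m" using lex by linarith
      then show ?thesis using 5 by (auto simp: p relocate_def)
    qed (use lex in \<open>auto simp: p relocate_def\<close>)
  qed
  have set: "set (?L w) = {p. ?C w p}" for w :: "'a list"
    using set_le_check_patterns[OF t1 tl(1)] .
  have L: "?L z' = map ?\<phi> (?L z)"
  proof (rule strict_sorted_equal)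
    show "sorted_wrt (<) (?L z')" by (rule sorted_le_check_patterns)
    show "sorted_wrt (<) (map ?\<phi> (?L z))"
      unfolding sorted_wrt_map
      by (rule sorted_wrt_mono_rel[OF _ sorted_le_check_patterns]) (use set mono in auto)
    show "set (?L z') = set (map ?\<phi> (?L z))"
    proof (intro set_eqI iffI)
      fix p' assume "p' \<in> set (map ?\<phi> (?L z))"
      then show "p' \<in> set (?L z')" unfolding set set_map using img by blast
    next
      fix p' assume "p' \<in> set (?L z')"
      then show "p' \<in> set (map ?\<phi> (?L z))" unfolding set set_map using pre by blast
    qed
  qed
  have "min_period (substr z' (?\<phi> p)) = min_period (substr z p) \<and>
       (substr z' (?\<phi> p) = substr z p \<or>
        check_pattern l t s z p \<and> delete_min_periods (substr z p) (substr z' (?\<phi> p)))"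
    if C: "?C z p" for p
  proof (cases p)
    case (Pair c e)
    have e: "c \<le> e" "e \<le> length z" using C unfolding Pair iff run_def by auto
    consider "(c, e) = (a, b + m)" | "c < a" "e < b" | "a + m < c" "b + m < e"
      using tri[of c e] C unfolding Pair by blast
    then show ?thesis
    proof cases
      case 1
      let ?W = "substr z p"
      have \<phi>: "?\<phi> p = (a, b)" using 1 by (simp add: Pair relocate_def)
      have take: "substr z' (a, b) = take (b - a) ?W"
        using 1 left bound lb by (intro nth_equalityI) (auto simp: Pair substr_def)
      have mp: "min_period ?W = T" "min_period (substr z' (a, b)) = T"
        using min_period_substr_run run run' 1 Pair by auto
      have "length (drop (b - a) ?W) = m" using 1 bound lb by (simp add: Pair substr_def)
      then have "drop (b - a) ?W \<noteq> []" "T dvd length (drop (b - a) ?W)" using Tm by auto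
      \<comment> \<open>The loss is charged to the end of the pattern, as one burst of
        \<open>m\<close> letters.\<close>
      from delete_burst.intros[OF this, of "take (b - a) ?W" "[]"]
      have "delete_burst T ?W (take (b - a) ?W)" by simp
      then have "delete_min_periods ?W (substr z' (a, b))"
        unfolding delete_min_periods_def mp(1) take by blast
      moreover have "check_pattern l t s z p"
        using run Ts lb st tl 1 unfolding Pair check_pattern_iff_run by auto
      ultimately show ?thesis using mp \<phi> by simp
    next
      case 2
      then have "substr z' (c, e) = substr z (c, e)"
        using left bound by (intro nth_equalityI) (auto simp: substr_def)
      then show ?thesis using 2 by (simp add: Pair relocate_def)
    next
      case 3
      then have "substr z' (c - m, e - m) = substr z (c, e)"
        using right bound len e by (intro nth_equalityI) (auto simp: substr_def add.commute)
      then show ?thesis using 3 by (simp add: Pair relocate_def)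
    qed
  qed
  note * = this
  have "length (?L z') = length (?L z)" using arg_cong[OF L, of length] by simp
  moreover have "?L z' ! i = ?\<phi> (?L z ! i)" "?C z (?L z ! i)" if "i < length (?L z)" for i
    using L nth_mem[OF that] set[of z] that by simp_all
  ultimately show ?thesis
    unfolding patterns_preserved_def list_all2_conv_all_nth using * by simp
qed

section \<open>From reads to deletions\<close>

lemma list_all2_sum_list_length_le:
  "list_all2 (\<lambda>H G. length H \<le> length G) Hs Gs \<Longrightarrow>
    sum_list (map length Hs) \<le> sum_list (map length Gs)"
  by (induction rule: list_all2_induct) auto

text \<open>Each gap is stored with the kept read that follows it. Reads after the last kept one
  have no place here and are handled as a separate tail.\<close>

definition glue :: "'a list list \<Rightarrow> 'a list \<Rightarrow> 'a list" where
  "glue Gs rs = concat (map2 (\<lambda>G r. G @ [r]) Gs rs)"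

lemma glue_Nil [simp]: "glue [] rs = []" "glue Gs [] = []"
  by (simp_all add: glue_def)

lemma glue_Cons [simp]: "glue (G # Gs) (r # rs) = G @ r # glue Gs rs"
  by (simp add: glue_def)

lemma glue_append:
  "length Gs = length rs \<Longrightarrow> glue (Gs @ Gs') (rs @ rs') = glue Gs rs @ glue Gs' rs'"
  by (simp add: glue_def)

lemma length_glue:
  "length Gs = length rs \<Longrightarrow> length (glue Gs rs) = sum_list (map length Gs) + length rs"
  by (induction Gs rs rule: list_induct2) auto

lemma set_glue:
  "length Gs = length rs \<Longrightarrow> set (glue Gs rs) = (\<Union>G\<in>set Gs. set G) \<union> set rs"
  by (induction Gs rs rule: list_induct2) auto

lemma subseq_glue: "length Gs = length rs \<Longrightarrow> subseq rs (glue Gs rs)"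
  by (induction Gs rs rule: list_induct2) auto

text \<open>Greedy embedding: every kept read is matched with its first possible occurrence, and
  skipped entries go into the gap before it.\<close>

lemma ex_glue_if_subseq:
  "subseq rs ys \<Longrightarrow> \<exists>Gs S. length Gs = length rs \<and> ys = glue Gs rs @ S"
proof (induction ys arbitrary: rs)
  case (Cons y ys)
  show ?case
  proof (cases rs)
    case Nil
    then show ?thesis by simp
  next
    case (Cons r rs')
    show ?thesis
    proof (cases "r = y")
      case True
      then have "subseq rs' ys" using Cons.prems Cons by simp
      then obtain Gs S where "length Gs = length rs'" "ys = glue Gs rs' @ S"
        using Cons.IH by blast
      then show ?thesis
        using Cons True by (intro exI[of _ "[] # Gs"]) auto
    next
      case False
      then have "subseq rs ys" using Cons.prems Cons by simp
      then obtain Gs S where "length Gs = length rs" "ys = glue Gs rs @ S"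
        using Cons.IH by blast
      moreover from this obtain G Gs' where "Gs = G # Gs'"
        using Cons by (cases Gs) auto
      ultimately show ?thesis
        using Cons by (intro exI[of _ "(y # G) # Gs'"]) auto
    qed
  qed
qed (auto dest: list_emb_Nil2)

lemma consistent_split:
  "consistent (X @ r # Y) \<longleftrightarrow> consistent (X @ [r]) \<and> consistent (r # Y)"
  by (auto simp: consistent_def successively_append_iff successively_Cons)

text \<open>Consistency is local between neighbouring kept reads, so the contents of different gaps
  can be exchanged independently.\<close>

lemma consistent_glue:
  "length Gs = length rs \<Longrightarrow> consistent (r # glue Gs rs) \<longleftrightarrow>
    (\<forall>i < length rs. consistent ((r # rs) ! i # Gs ! i @ [rs ! i]))"
proof (induction Gs rs arbitrary: r rule: list_induct2)
  case Nil
  show ?case by (simp add: consistent_def)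
next
  case (Cons G Gs r' rs)
  have "consistent (r # G @ r' # glue Gs rs) \<longleftrightarrow>
      consistent (r # G @ [r']) \<and> consistent (r' # glue Gs rs)"
    using consistent_split[of "r # G" r' "glue Gs rs"] by simp
  then show ?case using Cons.IH[of r'] by (simp add: All_less_Suc2)
qed

section \<open>The effect of refilling gaps on the underlying sequence\<close>

lemma inv_read_append:
  assumes "consistent (X @ r # Y)" "\<forall>w \<in> set (X @ r # Y). w \<noteq> []"
  shows "inv_read (X @ r # Y) = map hd X @ r @ map last Y"
  using assms
proof (induction X)
  case Nil
  then show ?case by (simp add: inv_read_def)
next
  case (Cons x X)
  obtain w W where w: "X @ r # Y = w # W" by (cases "X @ r # Y") auto
  have c: "tl x = butlast w" "consistent (X @ r # Y)"
    using Cons.prems(1) by (auto simp: consistent_def w)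
  have ne: "x \<noteq> []" "w \<noteq> []" using Cons.prems(2) unfolding append_Cons w by auto
  have "inv_read (x # w # W) = (hd x # butlast w) @ last w # map last W"
    using c ne by (simp add: inv_read_def flip: c(1))
  also have "\<dots> = hd x # inv_read (w # W)"
    using ne by (simp add: inv_read_def)
  finally show ?case using Cons.IH c(2) Cons.prems(2) w by simp
qed

text \<open>Read across the gap, both fillings give words that begin with \<open>r\<close> and end
  with \<open>r'\<close>, of lengths \<open>l + g + 1\<close> and \<open>l + h + 1\<close>. In the
  shorter word \<open>r\<close> and \<open>r'\<close> overlap in \<open>l - 1 - h\<close> letters.
  In the longer one these letters therefore occur twice at distance \<open>m\<close>, which is the
  required periodicity.\<close>

lemma inv_read_replace_gap:
  assumes cG: "consistent (X @ r # G @ r' # Y)" and cH: "consistent (X @ r # H @ r' # Y)"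
    and len: "\<forall>w \<in> set (X @ r # G @ r' # Y) \<union> set (X @ r # H @ r' # Y). length w = l"
    and HG: "length H \<le> length G" "length H \<le> s" "length G + s \<le> t + length H"
    and l: "s < l"
  shows "(deletion_step l t s)\<^sup>=\<^sup>= (inv_read (X @ r # G @ r' # Y)) (inv_read (X @ r # H @ r' # Y))"
proof -
  define g h m where "g = length G" and "h = length H" and "m = g - h"
  define W V where "W = r @ map last (G @ [r'])" and "V = r @ map last (H @ [r'])"
  have lr: "length r = l" "length r' = l" using len by auto
  have ne: "w \<noteq> []" if "w \<in> set (X @ r # G @ r' # Y) \<union> set (X @ r # H @ r' # Y)" for w
    using bspec[OF len that] l by auto
  have gap: "consistent (r # G @ [r'])" "consistent (r # H @ [r'])"
    using cG cH consistent_split[of X r "G @ r' # Y"] consistent_split[of X r "H @ r' # Y"]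
      consistent_split[of "r # G" r' Y] consistent_split[of "r # H" r' Y] by auto
  have z: "inv_read (X @ r # G @ r' # Y) = map hd X @ W @ map last Y"
    using inv_read_append[OF cG] ne by (auto simp: W_def)
  have z': "inv_read (X @ r # H @ r' # Y) = map hd X @ V @ map last Y"
    using inv_read_append[OF cH] ne by (auto simp: V_def)
  have "inv_read (r # G @ [r']) = W" by (simp add: inv_read_def W_def)
  moreover have "inv_read (r # G @ [r']) = map hd (r # G) @ r'"
    using inv_read_append[of "r # G" r' "[]"] gap(1) ne by auto
  ultimately have W: "W = map hd (r # G) @ r'" by simp
  have "inv_read (r # H @ [r']) = V" by (simp add: inv_read_def V_def)
  moreover have "inv_read (r # H @ [r']) = map hd (r # H) @ r'"
    using inv_read_append[of "r # H" r' "[]"] gap(2) ne by auto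
  ultimately have V: "V = map hd (r # H) @ r'" by simp
  have lenW: "length W = l + g + 1" by (simp add: W_def lr g_def)
  have lenV: "length V = l + h + 1" by (simp add: V_def lr h_def)
  have hl: "h < l" using HG l by (simp add: h_def)
  have dropW: "drop (g + 1) W = r'" by (simp add: W g_def)
  have dropV: "drop (h + 1) V = r'" by (simp add: V h_def)
  have W_r: "W ! i = r ! i" if "i < l" for i using that by (simp add: W_def lr nth_append)
  have V_r: "V ! i = r ! i" if "i < l" for i using that by (simp add: V_def lr nth_append)
  \<comment> \<open>Since \<open>h < l\<close>, these \<open>h + 1\<close> letters lie inside
    \<open>r\<close>, where the two words agree.\<close>
  have "take (h + 1) V = take (h + 1) r" "take (h + 1) W = take (h + 1) r"
    using hl lr by (simp_all add: V_def W_def)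
  then have V_eq: "V = take (h + 1) W @ drop (g + 1) W"
    using append_take_drop_id[of "h + 1" V] dropV dropW by simp
  show ?thesis
  proof (cases "h = g")
    case True
    then have "V = W" using V_eq by simp
    then show ?thesis by (simp add: z z')
  next
    case False
    then have m: "0 < m" "g = h + m" using HG by (auto simp: m_def g_def h_def)
    \<comment> \<open>The periodic part consists of the \<open>l - 1 - h\<close> overlapping letters
      plus the \<open>m\<close> letters to be cut; \<open>h <= s\<close> makes it long
      enough.\<close>
    define Q k where "Q = drop (h + 1) W" and "k = l - 1 - h + m"
    have lenQ: "length Q = l + m" using m by (simp add: Q_def lenW)
    have Qdrop: "drop m Q = drop (g + 1) W" using m by (simp add: Q_def add.commute)
    have mk: "m \<le> k" "k \<le> length Q" by (simp_all add: k_def lenQ)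
    have Q: "Q ! i = Q ! (i + m)" if "i + m < k" for i
    proof -
      have i: "h + 1 + i < l" using that by (simp add: k_def)
      have "Q ! i = r ! (h + 1 + i)" using W_r[OF i] i by (simp add: Q_def lenW)
      also have "\<dots> = drop (h + 1) V ! i"
        using V_r[OF i] lenV hl by simp
      also have "\<dots> = drop (g + 1) W ! i" unfolding dropV dropW by (rule refl)
      also have "\<dots> = Q ! (i + m)" unfolding Qdrop[symmetric] using lenQ by (simp add: add.commute)
      finally show ?thesis .
    qed
    have "deletion_step l t s (map hd X @ W @ map last Y) (map hd X @ V @ map last Y)"
      unfolding deletion_step_def
    proof (intro exI conjI)
      show "map hd X @ W @ map last Y =
        (map hd X @ take (h + 1) W) @ take k Q @ (drop k Q @ map last Y)"
        using append_take_drop_id[of "h + 1" W] append_take_drop_id[of k Q]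
        unfolding Q_def[symmetric] by (metis append.assoc)
      have "drop m (take k Q) @ drop k Q = drop m Q"
        using mk by (metis append_take_drop_id drop_append diff_is_0_eq drop_0 length_take min.absorb2)
      then show "map hd X @ V @ map last Y =
        (map hd X @ take (h + 1) W) @ drop m (take k Q) @ (drop k Q @ map last Y)"
        unfolding V_eq Qdrop[symmetric] by (metis append.assoc)
      show "0 < m" by (rule m)
      show "m + s \<le> t" using HG m by (simp add: g_def h_def)
      show "l + m \<le> length (take k Q) + 1 + s"
        using mk hl HG by (simp add: k_def h_def)
      show "seg_period ((!) (take k Q)) m 0 (length (take k Q))"
        using mk Q unfolding seg_period_def by auto
    qed
    then show ?thesis by (simp add: z z')
  qed
qed

text \<open>Gaps are replaced from left to right, with \<open>X\<close> collecting what has been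
  treated. As no gap grows, a single gap shrinks by at most the total excess, which is at most
  \<open>t - s\<close>.\<close>

lemma inv_read_replace_gaps:
  assumes "length Hs = length Gs" "length Gs = length rs"
    and "consistent (X @ r # glue Gs rs)" "consistent (X @ r # glue Hs rs)"
    and "\<forall>w \<in> set (X @ r # glue Gs rs) \<union> set (X @ r # glue Hs rs). length w = l"
    and "list_all2 (\<lambda>H G. length H \<le> length G) Hs Gs"
    and "\<forall>H \<in> set Hs. length H \<le> s"
    and "sum_list (map length Gs) + s \<le> t + sum_list (map length Hs)"
    and "s < l"
  shows "(deletion_step l t s)\<^sup>*\<^sup>* (inv_read (X @ r # glue Gs rs)) (inv_read (X @ r # glue Hs rs))"
  using assms
proof (induction Hs Gs rs arbitrary: X r rule: list_induct3)
  case (Cons H Hs G Gs r' rs)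
  have le: "sum_list (map length Hs) \<le> sum_list (map length Gs)"
    using Cons.prems(4) by (simp add: list_all2_sum_list_length_le)
  have HG: "length H \<le> length G" "length H \<le> s" "length G + s \<le> t + length H"
    using Cons.prems(4-6) le by auto
  have cG: "consistent (X @ r # G @ r' # glue Gs rs)" and cH: "consistent (X @ r # H @ r' # glue Hs rs)"
    using Cons.prems(1,2) by simp_all
  have c: "consistent (X @ r # H @ r' # glue Gs rs)"
    using cG cH consistent_split[of "X @ r # H" r' "glue Gs rs"]
      consistent_split[of "X @ r # H" r' "glue Hs rs"] consistent_split[of "X @ r # G" r' "glue Gs rs"]
    by simp
  have "(deletion_step l t s)\<^sup>=\<^sup>= (inv_read (X @ r # G @ r' # glue Gs rs))
      (inv_read (X @ r # H @ r' # glue Gs rs))"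
    using Cons.prems(3,7) HG by (intro inv_read_replace_gap[OF cG c]) auto
  moreover have "(deletion_step l t s)\<^sup>*\<^sup>* (inv_read ((X @ r # H) @ r' # glue Gs rs))
      (inv_read ((X @ r # H) @ r' # glue Hs rs))"
    using Cons.prems c cH le HG by (intro Cons.IH) auto
  ultimately show ?case by (auto intro: converse_rtranclp_into_rtranclp)
qed simp

section \<open>Elementary facts about read vectors\<close>

lemma length_read_vector: "length (read_vector l z) = Suc (length z) - l"
  by (simp add: read_vector_def)

lemma nth_read_vector:
  "i + l \<le> length z \<Longrightarrow> read_vector l z ! i = take l (drop i z)"
  by (auto simp: read_vector_def substr_def nth_append)

lemma consistent_read_vector: "consistent (read_vector l z)"
  unfolding consistent_def successively_conv_nth
proof (intro allI impI)
  fix i assume "Suc i < length (read_vector l z)"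
  then have i: "Suc i + l \<le> length z" by (simp add: length_read_vector)
  have "tl (take l (drop i z)) = take (l - 1) (drop (Suc i) z)"
    by (simp add: tl_take tl_drop drop_Suc)
  also have "\<dots> = butlast (take l (drop (Suc i) z))"
    using i by (simp add: butlast_take)
  finally show "tl (read_vector l z ! i) = butlast (read_vector l z ! Suc i)"
    using i by (simp add: nth_read_vector)
qed

lemma inv_read_read_vector:
  assumes "0 < l" "l \<le> length z"
  shows "inv_read (read_vector l z) = z"
proof -
  have upt: "[0..<Suc (length z) - l] = 0 # [1..<Suc (length z) - l]"
    using assms by (simp add: upt_conv_Cons)
  have "inv_read (read_vector l z) = take l z @ map (\<lambda>i. last (substr z (i, i + l))) [1..<Suc (length z) - l]"
    unfolding inv_read_def read_vector_def upt by (simp add: substr_def)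
  also have "map (\<lambda>i. last (substr z (i, i + l))) [1..<Suc (length z) - l] = drop l z"
    using assms by (intro nth_equalityI) (auto simp: substr_def last_conv_nth add.commute)
  finally show ?thesis by simp
qed

lemma read_vector_words: "z \<in> words q N \<Longrightarrow> set (read_vector l z) \<subseteq> words q l"
  by (auto simp: words_def read_vector_def substr_def dest!: in_set_takeD in_set_dropD)

lemma patterns_preserved_deletion_steps:
  assumes "(deletion_step l t s)\<^sup>*\<^sup>* z z'" "s < t" "t + 2 \<le> l" "2 * t \<le> l"
  shows "patterns_preserved l t s z z'"
  using assms(1)
proof (induction rule: rtranclp_induct)
  case base
  show ?case by (rule patterns_preserved_refl)
next
  case (step z' z'')
  then show ?case
    using patterns_preserved_deletion_step[OF step.hyps(2) assms(2-4)]
    by (intro patterns_preserved_trans[OF step.IH _ assms(2,3)])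
qed

theorem mainTheorem12:
  fixes q n l t s :: nat
    and u v x xt y :: "nat list"
    and D :: "nat set"
    and R1 R2 :: "nat list list"
  assumes "q \<ge> 2"
    and "u \<in> words q l" and "v \<in> words q l"
    and "x \<in> words q n"
    and "1 \<le> t" and "t + 2 \<le> l" and "2 * t \<le> l"
    and "xt = u @ x @ v"
    and "D \<subseteq> {1..<n + l}" and "card D = t"
    and "R1 = nths (read_vector l xt) (- D)"
    and "min_consistent_insertion q l R1 s R2" and "s < t"
    and "y = inv_read R2"
  shows "length (le_check_patterns l t (t - 1) xt) = length (le_check_patterns l t (t - 1) y)
    \<and> (\<forall>i < length (le_check_patterns l t (t - 1) y).
         let a = le_check_patterns l t (t - 1) xt ! i; p = substr xt a;
             p' = substr y (le_check_patterns l t (t - 1) y ! i)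
         in min_period p' = min_period p
          \<and> (\<not> check_pattern l t s xt a \<longrightarrow> p' = p)
          \<and> (check_pattern l t s xt a \<longrightarrow> p' = p \<or> delete_min_periods p p'))"
proof -
  define R where "R = read_vector l xt"
  have len_xt: "length xt = n + 2 * l" and xt: "xt \<in> words q (n + 2 * l)"
    using assms(2-4,8) by (auto simp: words_def)
  have lenR: "length R = n + l + 1" by (simp add: R_def length_read_vector len_xt)
  have Rq: "set R \<subseteq> words q l" unfolding R_def using xt by (rule read_vector_words)
  have cR: "consistent R" unfolding R_def by (rule consistent_read_vector)
  obtain r R' where "R = r # R'" using lenR by (cases R) auto
  moreover from this obtain Rm e where "R' = Rm @ [e]"
    using lenR assms(6) by (cases R' rule: rev_cases) auto
  ultimately have R: "R = r # Rm @ [e]" by simp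
  have lenRm: "length Rm + 1 = n + l" using lenR R by simp
  \<comment> \<open>The set \<open>D\<close> avoids both ends, so \<open>r\<close> and
    \<open>e\<close> survive; index \<open>j\<close> of \<open>Rm\<close> is index
    \<open>Suc j\<close> of \<open>R\<close>.\<close>
  have "0 \<in> - D" "n + l \<in> - D" using assms(9) by auto
  moreover define rs0 where "rs0 = nths Rm {j. Suc j \<in> - D}"
  ultimately have R1: "R1 = r # rs0 @ [e]"
    using lenRm unfolding assms(11) R_def[symmetric] R by (auto simp: nths_Cons nths_append)
  have "{i. i < length R \<and> i \<in> - D} = {..<n + l + 1} - D" by (auto simp: lenR)
  moreover have "D \<subseteq> {..<n + l + 1}" using assms(9) by auto
  ultimately have lenR1: "length R1 + t = length R"
    using assms(10) lenR card_mono[of "{..<n + l + 1}" D]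
    unfolding assms(11) R_def[symmetric] length_nths
    by (simp add: card_Diff_subset finite_subset)
  have "subseq rs0 Rm" using subseq_conv_nths rs0_def by blast
  then obtain Gs0 S where Gs0: "length Gs0 = length rs0" and Rm: "Rm = glue Gs0 rs0 @ S"
    using ex_glue_if_subseq by blast
  \<comment> \<open>Closing the last gap with \<open>e\<close> absorbs the tail \<open>S\<close>, so
    \<open>R\<close> is \<open>r\<close> followed only by gaps ending in kept reads.\<close>
  define rs Gs where "rs = rs0 @ [e]" and "Gs = Gs0 @ [S]"
  have R1_eq: "R1 = r # rs" by (simp add: R1 rs_def)
  have lenGs: "length Gs = length rs" by (simp add: Gs_def rs_def Gs0)
  have R_eq: "R = r # glue Gs rs"
    unfolding R Rm Gs_def rs_def glue_append[OF Gs0] by simp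
  have R2: "set R2 \<subseteq> words q l" "consistent R2" "subseq R1 R2" "length R2 = length R1 + s"
    and s_min: "\<And>s' R3. consistent_insertion q l R1 s' R3 \<Longrightarrow> s \<le> s'"
    using assms(12) by (auto simp: min_consistent_insertion_def consistent_insertion_def)
  obtain Hs0 S2 where Hs0: "length Hs0 = length R1" "R2 = glue Hs0 R1 @ S2"
    using ex_glue_if_subseq[OF R2(3)] by blast
  \<comment> \<open>A priori, reads may also have been inserted before the first kept read
    (\<open>P\<close>) or after the last one (\<open>S2\<close>).\<close>
  then obtain P Hs where Hs: "Hs0 = P # Hs" "length Hs = length rs"
    using R1_eq by (cases Hs0) auto
  \<comment> \<open>Trimming both ends still yields a consistent insertion, so minimality of
    \<open>s\<close> forces \<open>P\<close> and \<open>S2\<close> to be empty.\<close>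
  define M where "M = r # glue Hs rs"
  have R2_eq: "R2 = P @ M @ S2" by (simp add: Hs0 Hs R1_eq M_def)
  have sM: "set M \<subseteq> words q l" and cM: "consistent M"
    using R2(1,2) by (auto simp: R2_eq consistent_def successively_append_iff)
  have lenM: "length M = length R1 + sum_list (map length Hs)"
    by (simp add: M_def R1_eq length_glue Hs(2))
  have "consistent_insertion q l R1 (sum_list (map length Hs)) M"
    unfolding consistent_insertion_def using sM cM lenM Hs(2) subseq_glue
    by (auto simp: M_def R1_eq)
  then have "s \<le> sum_list (map length Hs)" by (rule s_min)
  moreover have "length P + length M + length S2 = length R1 + s"
    using R2(4) by (simp add: R2_eq)
  ultimately have sumH: "sum_list (map length Hs) = s" and "P = []" "S2 = []"
    unfolding lenM by auto
  then have R2_M: "R2 = M" by (simp add: R2_eq)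
  have sumG: "sum_list (map length Gs) = t"
    using lenR1 unfolding R_eq R1_eq by (simp add: length_glue lenGs)
  have Gq: "set (Gs ! i) \<subseteq> words q l" if "i < length rs" for i
  proof -
    have "Gs ! i \<in> set Gs" using that lenGs by simp
    then show ?thesis using Rq unfolding R_eq by (auto simp: set_glue[OF lenGs])
  qed
  have gap_le: "length (Hs ! i) \<le> length (Gs ! i)" if i: "i < length rs" for i
  proof -
    \<comment> \<open>Putting the original reads back into gap \<open>i\<close> is again a
      consistent insertion. By minimality it cannot use fewer reads, so the original gap is at least
      as long as the inserted one.\<close>
    let ?Hs = "Hs[i := Gs ! i]"
    have len: "length ?Hs = length rs" using Hs(2) by simp
    have "consistent (r # glue ?Hs rs)"
      unfolding consistent_glue[OF len]
    proof (intro allI impI)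
      fix j assume j: "j < length rs"
      show "consistent ((r # rs) ! j # ?Hs ! j @ [rs ! j])"
        using cR cM j i Hs(2) consistent_glue[OF lenGs, of r] consistent_glue[OF Hs(2), of r]
        by (cases "j = i") (simp_all add: R_eq M_def)
    qed
    moreover have "set (r # glue ?Hs rs) \<subseteq> words q l"
    proof -
      have "(\<Union>G\<in>set ?Hs. set G) \<subseteq> (\<Union>G\<in>set Hs. set G) \<union> set (Gs ! i)"
        using set_update_subset_insert[of Hs i "Gs ! i"] by fast
      then show ?thesis
        using Gq[OF i] sM by (auto simp: set_glue[OF len] M_def set_glue[OF Hs(2)])
    qed
    ultimately have "consistent_insertion q l R1 (sum_list (map length ?Hs)) (r # glue ?Hs rs)"
      unfolding consistent_insertion_def using subseq_glue[OF len]
      by (auto simp: R1_eq length_glue[OF len])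
    then have "s \<le> sum_list (map length ?Hs)" by (rule s_min)
    also have "\<dots> = s + length (Gs ! i) - length (Hs ! i)"
      using i Hs(2) sumH by (simp add: map_update sum_list_update)
    finally have "s \<le> s + length (Gs ! i) - length (Hs ! i)" .
    \<comment> \<open>This rules out truncation in the subtraction above.\<close>
    moreover have "length (Hs ! i) \<le> s"
      using i Hs(2) unfolding sumH[symmetric] by (intro member_le_sum_list) auto
    ultimately show ?thesis by linarith
  qed
  have "(deletion_step l t s)\<^sup>*\<^sup>* (inv_read ([] @ r # glue Gs rs)) (inv_read ([] @ r # glue Hs rs))"
  proof (rule inv_read_replace_gaps)
    show "length Hs = length Gs" "length Gs = length rs" using Hs(2) lenGs by simp_all
    show "consistent ([] @ r # glue Gs rs)" "consistent ([] @ r # glue Hs rs)"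
      using cR cM by (simp_all add: R_eq M_def)
    have "set R \<union> set M \<subseteq> words q l" using Rq sM by simp
    then show "\<forall>w\<in>set ([] @ r # glue Gs rs) \<union> set ([] @ r # glue Hs rs). length w = l"
      unfolding R_eq M_def by (auto simp: words_def)
    show "list_all2 (\<lambda>H G. length H \<le> length G) Hs Gs"
      using gap_le Hs(2) lenGs by (simp add: list_all2_conv_all_nth)
    show "\<forall>H\<in>set Hs. length H \<le> s"
      unfolding sumH[symmetric] by (intro ballI member_le_sum_list) auto
    show "sum_list (map length Gs) + s \<le> t + sum_list (map length Hs)"
      by (simp add: sumG sumH)
    show "s < l" using assms(6,13) by simp
  qed
  moreover have "inv_read R = xt"
    unfolding R_def using assms(6) len_xt by (intro inv_read_read_vector) auto
  ultimately have "(deletion_step l t s)\<^sup>*\<^sup>* xt y"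
    unfolding assms(14) R2_M M_def R_eq by simp
  then have "patterns_preserved l t s xt y"
    using assms(13,6,7) by (rule patterns_preserved_deletion_steps)
  then show ?thesis
    unfolding patterns_preserved_def list_all2_conv_all_nth Let_def by auto
qed

end
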